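(* Let $G$ be a connected, simply connected complex semisimple linear algebraic group with Borel subgroup $B$, maximal torus $T\subset B$ and Weyl group $W$. Let $\eta\colon\mathbb{C}^\times\to T$ be a cocharacter, $G'=Z_G(\eta(\mathbb{C}^\times))$, $B'=G'\cap B$, with Weyl group $W'\subset W$, and let $\mathcal{F}=G/B$ and $\mathcal{F}'=G'/B'$. Let $\varsigma\in W$ have minimal length in its coset $W'\varsigma$, let $\iota_\varsigma\colon\mathcal{F}'\hookrightarrow\mathcal{F}$ be the corresponding section of the pattern map, and write also $\iota_\varsigma\colon(\mathcal{F}')^T\to\mathcal{F}^T$ for its restriction to $T$-fixed points. Let $\phi\in K^0_T(\mathcal{F}^T)=\mathrm{Maps}(W,R(T))$. Then for every $w\in W'$, the pullback $\iota_\varsigma^*(\phi)\in K^0_T((\mathcal{F}')^T)=\mathrm{Maps}(W',R(T))$ satisfies $\iota_\varsigma^*(\phi)(w)=\phi(w\varsigma)$.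
   Context: Groups. $W=N_G(T)/T$ is the Weyl group of $G$, with length function determined by $B$. With $T_\eta=\eta(\mathbb{C}^\times)$, the centralizer $G'=Z_G(T_\eta)$ is a connected reductive group with maximal torus $T$, $B'=G'\cap B$ is a Borel subgroup of $G'$, and $W'=N_{G'}(T)/T\subset W$ is its Weyl group. Cosets are right cosets $W'\varsigma\in W'\backslash W$. Pattern map. Points of $\mathcal{F}=G/B$ are identified with Borel subgroups of $G$, $gB\leftrightarrow gBg^{-1}$; write $w.B$ for the $T$-fixed point of $\mathcal{F}$ corresponding to $w\in W$ (and $w.B'\in\mathcal{F}'$ for $w\in W'$). Let $\mathcal{F}^\eta$ be the set of $T_\eta$-fixed points of $\mathcal{F}$. The pattern map $\psi\colon\mathcal{F}^\eta\to\mathcal{F}'$ sends $B_0$ to $B_0\cap G'$; it is $G'$-equivariant and restricts to an isomorphism from each connected component of $\mathcal{F}^\eta$ onto $\mathcal{F}'$, and the components are in bijection with $W'\backslash W$. For $\varsigma$ of minimal length in $W'\varsigma$, the section $\iota_\varsigma\colon\mathcal{F}'\to\mathcal{F}$ is the inverse of $\psi$ on the component corresponding to $W'\varsigma$; it is the unique $G'$-equivariant map with $\iota_\varsigma(e.B')=\varsigma.B$. Localization. $K^0_T(Y)$ is the Grothendieck ring of $T$-equivariant vector bundles on $Y$, with pullback maps given by pullback of bundles, and $R(T)=K^0_T(\mathrm{pt})$ is the representation ring of $T$. The $T$-fixed points $\mathcal{F}^T=\{w.B\mid w\in W\}$ are identified with $W$, so $K^0_T(\mathcal{F}^T)=\bigoplus_{w\in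 W}R(T)=\mathrm{Maps}(W,R(T))$, where the value of a class at $w$ is its restriction to the point $w.B$. Likewise $(\mathcal{F}')^T=\{w.B'\mid w\in W'\}$ and $K^0_T((\mathcal{F}')^T)=\mathrm{Maps}(W',R(T))$. *)

theory Defs
  imports
    "HOL-Analysis.Analysis"
    "HOL-Algebra.Solvable_Groups"
    "HOL-Algebra.Group_Action"
    "HOL-Algebra.Product_Groups"
    "HOL-Algebra.QuotRing"
    "HOL-Library.Poly_Mapping"
    "Jordan_Normal_Form.Matrix"
begin

section \<open>Linear algebraic groups over the complex numbers\<close>

text \<open>
  A linear algebraic group is a Zariski closed subgroup of \<open>GL\<^sub>n(\<complex>)\<close>, for an arbitrary \<open>n\<close> given
  as the cardinality of the index type. Such a group is represented by its underlying set of
  matrices; \<open>lin G\<close> is the corresponding group in the sense of \<open>HOL-Algebra\<close>.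
\<close>

definition GL :: "(complex^'n^'n) monoid" where
  "GL = \<lparr>carrier = {A. invertible A}, monoid.mult = (\<lambda>A B. A ** B),
         one = Finite_Cartesian_Product.mat 1\<rparr>"

abbreviation lin :: "(complex^'n^'n) set \<Rightarrow> (complex^'n^'n) monoid" where
  "lin G \<equiv> GL\<lparr>carrier := G\<rparr>"

definition conjugate_set :: "complex^'n^'n \<Rightarrow> (complex^'n^'n) set \<Rightarrow> (complex^'n^'n) set" where
  "conjugate_set g S = (g <#\<^bsub>GL\<^esub> S) #>\<^bsub>GL\<^esub> (inv\<^bsub>GL\<^esub> g)"

definition centralizer :: "(complex^'n^'n) set \<Rightarrow> (complex^'n^'n) set \<Rightarrow> (complex^'n^'n) set" where
  "centralizer G S = {g \<in> G. \<forall>s\<in>S. g \<otimes>\<^bsub>GL\<^esub> s = s \<otimes>\<^bsub>GL\<^esub> g}"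

text \<open>The \<open>\<complex>\<close>-algebra of functions generated by a given set of functions.\<close>

inductive_set generated_algebra :: "('a \<Rightarrow> complex) set \<Rightarrow> ('a \<Rightarrow> complex) set"
  for gens :: "('a \<Rightarrow> complex) set" where
  const: "(\<lambda>_. c) \<in> generated_algebra gens"
| gen: "f \<in> gens \<Longrightarrow> f \<in> generated_algebra gens"
| add: "f \<in> generated_algebra gens \<Longrightarrow> g \<in> generated_algebra gens \<Longrightarrow>
    (\<lambda>x. f x + g x) \<in> generated_algebra gens"
| mult: "f \<in> generated_algebra gens \<Longrightarrow> g \<in> generated_algebra gens \<Longrightarrow>
    (\<lambda>x. f x * g x) \<in> generated_algebra gens"

definition matrix_entries :: "(complex^'n^'n \<Rightarrow> complex) set" where
  "matrix_entries = {(\<lambda>A. vec_nth (vec_nth A i) j) | i j. True}"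

abbreviation polynomial_functions :: "(complex^'n^'n \<Rightarrow> complex) set" where
  "polynomial_functions \<equiv> generated_algebra matrix_entries"

definition zariski_open :: "(complex^'n^'n) set \<Rightarrow> bool" where
  "zariski_open U \<longleftrightarrow>
     (\<exists>P \<subseteq> polynomial_functions. U = {A \<in> carrier GL. \<exists>p\<in>P. p A \<noteq> 0})"

definition zariski :: "(complex^'n^'n) topology" where
  "zariski = topology zariski_open"

lemma istopology_zariski_open: "istopology zariski_open"
  unfolding istopology_def
proof (intro conjI allI impI)
  fix S U :: "(complex^'n^'n) set"
  assume "zariski_open S" "zariski_open U"
  then obtain P Q where P: "P \<subseteq> polynomial_functions" "S = {A \<in> carrier GL. \<exists>p\<in>P. p A \<noteq> 0}"
    and Q: "Q \<subseteq> polynomial_functions" "U = {A \<in> carrier GL. \<exists>p\<in>Q. p A \<noteq> 0}"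
    unfolding zariski_open_def by (elim exE conjE)
  define R where "R = {\<lambda>A. p A * q A | p q. p \<in> P \<and> q \<in> Q}"
  have "R \<subseteq> polynomial_functions"
  proof
    fix r assume "r \<in> R"
    then obtain p q where "r = (\<lambda>A. p A * q A)" "p \<in> P" "q \<in> Q"
      unfolding R_def by (elim CollectE exE conjE)
    then show "r \<in> polynomial_functions"
      using P(1) Q(1) generated_algebra.mult[of p _ q] by (simp add: subset_iff)
  qed
  moreover have "(\<exists>r\<in>R. r A \<noteq> 0) \<longleftrightarrow> (\<exists>p\<in>P. p A \<noteq> 0) \<and> (\<exists>q\<in>Q. q A \<noteq> 0)" for A
  proof
    assume "\<exists>r\<in>R. r A \<noteq> 0"
    then obtain p q where "p A * q A \<noteq> 0" "p \<in> P" "q \<in> Q"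
      unfolding R_def by (elim bexE CollectE exE conjE) simp
    then show "(\<exists>p\<in>P. p A \<noteq> 0) \<and> (\<exists>q\<in>Q. q A \<noteq> 0)" by auto
  next
    assume "(\<exists>p\<in>P. p A \<noteq> 0) \<and> (\<exists>q\<in>Q. q A \<noteq> 0)"
    then obtain p q where pq: "p \<in> P" "q \<in> Q" "p A \<noteq> 0" "q A \<noteq> 0"
      by (elim conjE bexE)
    have "(\<lambda>A. p A * q A) \<in> R"
      unfolding R_def by (intro CollectI exI conjI) (rule refl pq)+
    moreover have "p A * q A \<noteq> 0" using pq by simp
    ultimately show "\<exists>r\<in>R. r A \<noteq> 0" by (intro bexI[where x = "\<lambda>A. p A * q A"])
  qed
  then have "S \<inter> U = {A \<in> carrier GL. \<exists>p\<in>R. p A \<noteq> 0}"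
    unfolding P(2) Q(2) by (simp only: Int_def mem_Collect_eq) metis
  ultimately show "zariski_open (S \<inter> U)"
    unfolding zariski_open_def by (intro exI conjI)
next
  fix \<K> :: "(complex^'n^'n) set set"
  assume "\<forall>K\<in>\<K>. zariski_open K"
  then have "\<forall>K\<in>\<K>. \<exists>P. P \<subseteq> polynomial_functions \<and> K = {A \<in> carrier GL. \<exists>p\<in>P. p A \<noteq> 0}"
    unfolding zariski_open_def .
  from bchoice[OF this] obtain P where
    P: "\<forall>K\<in>\<K>. P K \<subseteq> polynomial_functions \<and> K = {A \<in> carrier GL. \<exists>p\<in>P K. p A \<noteq> 0}" ..
  have "\<Union>\<K> = (\<Union>K\<in>\<K>. {A \<in> carrier GL. \<exists>p\<in>P K. p A \<noteq> 0})"
  proof -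
    have "(\<Union>K\<in>\<K>. {A \<in> carrier GL. \<exists>p\<in>P K. p A \<noteq> 0}) = (\<Union>K\<in>\<K>. K)"
      using P by (intro SUP_cong refl) (rule conjunct2[THEN sym], erule bspec)
    then show ?thesis by simp
  qed
  also have "\<dots> = {A \<in> carrier GL. \<exists>p\<in>(\<Union>K\<in>\<K>. P K). p A \<noteq> 0}"
    by auto
  finally have "\<Union>\<K> = {A \<in> carrier GL. \<exists>p\<in>(\<Union>K\<in>\<K>. P K). p A \<noteq> 0}" .
  moreover have "(\<Union>K\<in>\<K>. P K) \<subseteq> polynomial_functions"
    using P by (intro UN_least) simp
  ultimately show "zariski_open (\<Union>\<K>)"
    unfolding zariski_open_def by (intro exI conjI)
qed

definition linear_algebraic_group :: "(complex^'n^'n) set \<Rightarrow> bool" where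
  "linear_algebraic_group G \<longleftrightarrow> subgroup G GL \<and> closedin zariski G"

definition connected_algebraic_group :: "(complex^'n^'n) set \<Rightarrow> bool" where
  "connected_algebraic_group G \<longleftrightarrow> linear_algebraic_group G \<and> connectedin zariski G"

definition identity_component :: "(complex^'n^'n) set \<Rightarrow> (complex^'n^'n) set" where
  "identity_component H = connected_component_of_set (subtopology zariski H) \<one>\<^bsub>GL\<^esub>"

text \<open>Semisimple means that the radical (the largest connected solvable closed normal
  subgroup) is trivial.\<close>

definition semisimple_group :: "(complex^'n^'n) set \<Rightarrow> bool" where
  "semisimple_group G \<longleftrightarrow> connected_algebraic_group G \<and>
     (\<forall>H. H \<lhd> lin G \<and> connected_algebraic_group H \<and> solvable (lin H) \<longrightarrow> H = {\<one>\<^bsub>GL\<^esub>})"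

definition borel_subgroup :: "(complex^'n^'n) set \<Rightarrow> (complex^'n^'n) set \<Rightarrow> bool" where
  "borel_subgroup G B \<longleftrightarrow>
     connected_algebraic_group B \<and> solvable (lin B) \<and> B \<subseteq> G \<and>
     (\<forall>H. connected_algebraic_group H \<and> solvable (lin H) \<and> B \<subseteq> H \<and> H \<subseteq> G \<longrightarrow> H = B)"

definition regular_on :: "('a \<Rightarrow> complex) set \<Rightarrow> 'a set \<Rightarrow> ('a \<Rightarrow> complex) \<Rightarrow> bool" where
  "regular_on gens X f \<longleftrightarrow> (\<exists>p \<in> generated_algebra gens. \<forall>x\<in>X. f x = p x)"

text \<open>Generators of the coordinate ring of a closed subgroup of \<open>GL\<^sub>n\<close>.\<close>

definition group_coordinates :: "(complex^'n^'n \<Rightarrow> complex) set" where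
  "group_coordinates = matrix_entries \<union> {\<lambda>A. 1 / Determinants.det A}"

definition Gm :: "complex monoid" where
  "Gm = \<lparr>carrier = UNIV - {0}, monoid.mult = (*), one = 1\<rparr>"

abbreviation Gm_power :: "nat \<Rightarrow> (nat \<Rightarrow> complex) monoid" where
  "Gm_power r \<equiv> product_group {..<r} (\<lambda>_. Gm)"

definition torus_coordinates :: "nat \<Rightarrow> ((nat \<Rightarrow> complex) \<Rightarrow> complex) set" where
  "torus_coordinates r = (\<Union>i<r. {\<lambda>x. x i, \<lambda>x. 1 / x i})"

text \<open>A torus is a linear algebraic group isomorphic, as an algebraic group, to
  \<open>(\<complex>\<^sup>\<times>)\<^sup>r\<close> for some \<open>r\<close>.\<close>

definition torus :: "(complex^'n^'n) set \<Rightarrow> bool" where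
  "torus T \<longleftrightarrow> linear_algebraic_group T \<and>
     (\<exists>r. \<exists>f \<in> iso (Gm_power r) (lin T).
        (\<forall>i j. regular_on (torus_coordinates r) (carrier (Gm_power r))
                 (\<lambda>x. vec_nth (vec_nth (f x) i) j)) \<and>
        (\<forall>k<r. regular_on group_coordinates T
                 (\<lambda>t. inv_into (carrier (Gm_power r)) f t k)))"

definition maximal_torus :: "(complex^'n^'n) set \<Rightarrow> (complex^'n^'n) set \<Rightarrow> bool" where
  "maximal_torus G T \<longleftrightarrow>
     torus T \<and> T \<subseteq> G \<and> (\<forall>T'. torus T' \<and> T \<subseteq> T' \<and> T' \<subseteq> G \<longrightarrow> T' = T)"

definition cocharacter :: "(complex^'n^'n) set \<Rightarrow> (complex \<Rightarrow> complex^'n^'n) \<Rightarrow> bool" where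
  "cocharacter T \<eta> \<longleftrightarrow> \<eta> \<in> hom Gm (lin T) \<and>
     (\<forall>i j. regular_on {\<lambda>z. z, \<lambda>z. 1 / z} (carrier Gm) (\<lambda>z. vec_nth (vec_nth (\<eta> z) i) j))"

section \<open>Weyl groups and the length function\<close>

text \<open>Elements of the Weyl group are cosets of \<open>T\<close>; thus for \<open>T \<subseteq> H \<subseteq> G\<close> the Weyl group of
  \<open>H\<close> is literally a subset of that of \<open>G\<close>.\<close>

definition weyl_group :: "(complex^'n^'n) set \<Rightarrow> (complex^'n^'n) set \<Rightarrow> (complex^'n^'n) set monoid"
  where "weyl_group G T = lin (normalizer (lin G) T) Mod T"

text \<open>The Lie algebra as the Zariski tangent space at the identity: the tangent vectors along
  which the derivative of every polynomial vanishing on \<open>H\<close> is zero.\<close>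

definition lie_algebra :: "(complex^'n^'n) set \<Rightarrow> (complex^'n^'n) set" where
  "lie_algebra H = {X. \<forall>p \<in> polynomial_functions. (\<forall>A\<in>H. p A = 0) \<longrightarrow>
     ((\<lambda>z. p (\<one>\<^bsub>GL\<^esub> + map_matrix ((*) z) X)) has_field_derivative 0) (at 0)}"

text \<open>The nontrivial weights of \<open>T\<close> on the Lie algebra of \<open>H\<close>; for \<open>H = G\<close> these are the roots,
  and for \<open>H = B\<close> the positive roots determined by \<open>B\<close>.\<close>

definition roots :: "(complex^'n^'n) set \<Rightarrow> (complex^'n^'n) set \<Rightarrow> (complex^'n^'n \<Rightarrow> complex) set"
  where "roots H T = {\<alpha> \<in> extensional T. (\<exists>t\<in>T. \<alpha> t \<noteq> 1) \<and>
     (\<exists>X \<in> lie_algebra H. X \<noteq> 0 \<and>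
        (\<forall>t\<in>T. t ** X ** (inv\<^bsub>GL\<^esub> t) = map_matrix ((*) (\<alpha> t)) X))}"

text \<open>Characters are written multiplicatively, so a sum of roots is a product of functions.\<close>

definition simple_roots ::
    "(complex^'n^'n) set \<Rightarrow> (complex^'n^'n) set \<Rightarrow> (complex^'n^'n \<Rightarrow> complex) set" where
  "simple_roots B T = {\<alpha> \<in> roots B T.
     \<not> (\<exists>\<beta> \<in> roots B T. \<exists>\<gamma> \<in> roots B T. \<forall>t\<in>T. \<alpha> t = \<beta> t * \<gamma> t)}"

text \<open>The reflection in a root \<open>\<alpha>\<close> is the nontrivial element of the Weyl group (of order two) of
  the centralizer of \<open>(ker \<alpha>)\<degree>\<close>.\<close>

definition simple_reflections ::
    "(complex^'n^'n) set \<Rightarrow> (complex^'n^'n) set \<Rightarrow> (complex^'n^'n) set \<Rightarrow> (complex^'n^'n) set set"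
  where "simple_reflections G B T =
     (\<Union>\<alpha> \<in> simple_roots B T.
        carrier (weyl_group (centralizer G (identity_component {t \<in> T. \<alpha> t = 1})) T)
          - {\<one>\<^bsub>weyl_group G T\<^esub>})"

definition weyl_length ::
    "(complex^'n^'n) set \<Rightarrow> (complex^'n^'n) set \<Rightarrow> (complex^'n^'n) set \<Rightarrow> (complex^'n^'n) set \<Rightarrow> nat"
  where "weyl_length G B T w =
     (LEAST k. \<exists>ss. length ss = k \<and> set ss \<subseteq> simple_reflections G B T \<and>
        foldr (\<lambda>s v. s \<otimes>\<^bsub>weyl_group G T\<^esub> v) ss \<one>\<^bsub>weyl_group G T\<^esub> = w)"

section \<open>Flag varieties and the pattern map\<close>

text \<open>The coset \<open>gB\<close> is identified with the subgroup \<open>gBg\<^sup>-\<^sup>1\<close>, and \<open>G\<close> acts by conjugation.\<close>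

definition flag_variety :: "(complex^'n^'n) set \<Rightarrow> (complex^'n^'n) set \<Rightarrow> (complex^'n^'n) set set"
  where "flag_variety G B = (\<lambda>g. conjugate_set g B) ` G"

text \<open>The point \<open>w.B\<close>: all representatives of the coset \<open>w\<close> give the same subgroup.\<close>

definition flag_point :: "(complex^'n^'n) set \<Rightarrow> (complex^'n^'n) set \<Rightarrow> (complex^'n^'n) set" where
  "flag_point B w = the_elem ((\<lambda>g. conjugate_set g B) ` w)"

definition fixed_points ::
    "(complex^'n^'n) set \<Rightarrow> (complex^'n^'n) set set \<Rightarrow> (complex^'n^'n) set set" where
  "fixed_points S Y = {b \<in> Y. \<forall>s\<in>S. conjugate_set s b = b}"

text \<open>The Zariski topology of \<open>G/B\<close> is the quotient of that of \<open>G\<close>.\<close>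

definition flag_open ::
    "(complex^'n^'n) set \<Rightarrow> (complex^'n^'n) set \<Rightarrow> (complex^'n^'n) set set \<Rightarrow> bool" where
  "flag_open G B U \<longleftrightarrow> U \<subseteq> flag_variety G B \<and>
     openin (subtopology zariski G) {g \<in> G. conjugate_set g B \<in> U}"

definition flag_topology ::
    "(complex^'n^'n) set \<Rightarrow> (complex^'n^'n) set \<Rightarrow> (complex^'n^'n) set topology" where
  "flag_topology G B = topology (flag_open G B)"

lemma istopology_flag_open: "istopology (flag_open G B)"
  unfolding istopology_def
proof (intro conjI allI impI)
  fix S U assume "flag_open G B S" "flag_open G B U"
  moreover have "{g \<in> G. conjugate_set g B \<in> S \<inter> U} =
      {g \<in> G. conjugate_set g B \<in> S} \<inter> {g \<in> G. conjugate_set g B \<in> U}" by auto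
  ultimately show "flag_open G B (S \<inter> U)"
    unfolding flag_open_def by (auto intro: openin_Int)
next
  fix \<K> assume *: "\<forall>K\<in>\<K>. flag_open G B K"
  have "{g \<in> G. conjugate_set g B \<in> \<Union>\<K>} = (\<Union>K\<in>\<K>. {g \<in> G. conjugate_set g B \<in> K})" by auto
  moreover have "openin (subtopology zariski G) (\<Union>K\<in>\<K>. {g \<in> G. conjugate_set g B \<in> K})"
    using * unfolding flag_open_def by (intro openin_Union) auto
  ultimately show "flag_open G B (\<Union>\<K>)"
    using * unfolding flag_open_def by (simp add: Union_least)
qed

definition cocharacter_image :: "(complex \<Rightarrow> complex^'n^'n) \<Rightarrow> (complex^'n^'n) set" where
  "cocharacter_image \<eta> = \<eta> ` carrier Gm"

abbreviation pattern_group ::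
    "(complex^'n^'n) set \<Rightarrow> (complex \<Rightarrow> complex^'n^'n) \<Rightarrow> (complex^'n^'n) set" where
  "pattern_group G \<eta> \<equiv> centralizer G (cocharacter_image \<eta>)"

abbreviation pattern_borel ::
    "(complex^'n^'n) set \<Rightarrow> (complex^'n^'n) set \<Rightarrow> (complex \<Rightarrow> complex^'n^'n) \<Rightarrow> (complex^'n^'n) set"
  where "pattern_borel G B \<eta> \<equiv> pattern_group G \<eta> \<inter> B"

abbreviation pattern_flag_variety ::
    "(complex^'n^'n) set \<Rightarrow> (complex^'n^'n) set \<Rightarrow> (complex \<Rightarrow> complex^'n^'n) \<Rightarrow>
     (complex^'n^'n) set set"
  where "pattern_flag_variety G B \<eta> \<equiv> flag_variety (pattern_group G \<eta>) (pattern_borel G B \<eta>)"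

definition pattern_map ::
    "(complex^'n^'n) set \<Rightarrow> (complex \<Rightarrow> complex^'n^'n) \<Rightarrow> (complex^'n^'n) set \<Rightarrow> (complex^'n^'n) set"
  where "pattern_map G \<eta> b = b \<inter> pattern_group G \<eta>"

text \<open>
  \<open>C\<close> is the connected component of the \<open>\<eta>\<close>-fixed locus corresponding to the coset \<open>c\<close> of the
  Weyl group of \<open>Z\<^sub>G(\<eta>)\<close>: its \<open>T\<close>-fixed points include \<open>v.B\<close> for all \<open>v\<close> in \<open>c\<close>.
\<close>

definition pattern_component ::
    "(complex^'n^'n) set \<Rightarrow> (complex^'n^'n) set \<Rightarrow> (complex \<Rightarrow> complex^'n^'n) \<Rightarrow>
     (complex^'n^'n) set set \<Rightarrow> (complex^'n^'n) set set \<Rightarrow> bool"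
  where "pattern_component G B \<eta> c C \<longleftrightarrow>
     C \<in> connected_components_of
           (subtopology (flag_topology G B)
              (fixed_points (cocharacter_image \<eta>) (flag_variety G B))) \<and>
     flag_point B ` c \<subseteq> C"

text \<open>
  \<open>\<iota>\<close> is the section attached to \<open>\<sigma>\<close>: the inverse of the pattern map on the component
  corresponding to the coset of \<open>\<sigma>\<close>, which is the unique equivariant map sending the base point
  \<open>e.B'\<close> to \<open>\<sigma>.B\<close>. (Such a section exists when \<open>\<sigma>\<close> has minimal length in its coset.)
\<close>

definition pattern_section ::
    "(complex^'n^'n) set \<Rightarrow> (complex^'n^'n) set \<Rightarrow> (complex^'n^'n) set \<Rightarrow>
     (complex \<Rightarrow> complex^'n^'n) \<Rightarrow> (complex^'n^'n) set \<Rightarrow>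
     ((complex^'n^'n) set \<Rightarrow> (complex^'n^'n) set) \<Rightarrow> bool"
  where "pattern_section G B T \<eta> \<sigma> \<iota> \<longleftrightarrow>
     (let G' = pattern_group G \<eta>; B' = pattern_borel G B \<eta>; F' = pattern_flag_variety G B \<eta>;
          W = weyl_group G T; W' = weyl_group G' T
      in (\<exists>C. pattern_component G B \<eta> (carrier W' #>\<^bsub>W\<^esub> \<sigma>) C \<and>
              bij_betw (pattern_map G \<eta>) C F' \<and>
              (\<forall>b\<in>F'. \<iota> b = inv_into C (pattern_map G \<eta>) b)) \<and>
         (\<forall>g\<in>G'. \<forall>b\<in>F'. \<iota> (conjugate_set g b) = conjugate_set g (\<iota> b)) \<and>
         \<iota> (flag_point B' \<one>\<^bsub>W'\<^esub>) = flag_point B \<sigma>)"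

section \<open>Equivariant K-theory of discrete fixed point sets\<close>

text \<open>
  On a finite discrete variety \<open>Y\<close> with trivial \<open>T\<close>-action, a \<open>T\<close>-equivariant vector bundle is a
  family of rational representations of \<open>T\<close>, one for each point of \<open>Y\<close> (values outside \<open>Y\<close> do not
  matter: families agreeing on \<open>Y\<close> are isomorphic). Fibres are taken to be \<open>\<complex>\<^sup>m\<close>, so
  that a representation is a homomorphism into matrices of varying size.
\<close>

type_synonym ('y, 'g) rep_family = "'y \<Rightarrow> 'g \<Rightarrow> complex Matrix.mat"

definition rational_representation ::
    "(complex^'n^'n) set \<Rightarrow> nat \<Rightarrow> (complex^'n^'n \<Rightarrow> complex Matrix.mat) \<Rightarrow> bool" where
  "rational_representation T m \<rho> \<longleftrightarrow>
     (\<forall>t\<in>T. \<rho> t \<in> carrier_mat m m) \<and> \<rho> \<one>\<^bsub>GL\<^esub> = 1\<^sub>m m \<and>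
     (\<forall>s\<in>T. \<forall>t\<in>T. \<rho> (s \<otimes>\<^bsub>GL\<^esub> t) = \<rho> s * \<rho> t) \<and>
     (\<forall>i<m. \<forall>j<m. regular_on group_coordinates T (\<lambda>t. \<rho> t $$ (i, j)))"

definition vector_bundles :: "(complex^'n^'n) set \<Rightarrow> 'y set \<Rightarrow> ('y, complex^'n^'n) rep_family set" where
  "vector_bundles T Y = {E. \<forall>y\<in>Y. \<exists>m. rational_representation T m (E y)}"

definition bundle_rank :: "('y, complex^'n^'n) rep_family \<Rightarrow> 'y \<Rightarrow> nat" where
  "bundle_rank E y = dim_row (E y \<one>\<^bsub>GL\<^esub>)"

definition bundle_hom ::
    "(complex^'n^'n) set \<Rightarrow> 'y set \<Rightarrow> ('y, complex^'n^'n) rep_family \<Rightarrow> ('y, complex^'n^'n) rep_family \<Rightarrow>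
     ('y \<Rightarrow> complex Matrix.mat) set" where
  "bundle_hom T Y E F = {h. \<forall>y\<in>Y. h y \<in> carrier_mat (bundle_rank F y) (bundle_rank E y) \<and>
     (\<forall>t\<in>T. h y * E y t = F y t * h y)}"

definition short_exact ::
    "(complex^'n^'n) set \<Rightarrow> 'y set \<Rightarrow> ('y, complex^'n^'n) rep_family \<Rightarrow> ('y, complex^'n^'n) rep_family \<Rightarrow> ('y, complex^'n^'n) rep_family \<Rightarrow> bool"
  where "short_exact T Y E' E E'' \<longleftrightarrow>
     (\<exists>i \<in> bundle_hom T Y E' E. \<exists>p \<in> bundle_hom T Y E E''. \<forall>y\<in>Y.
        inj_on (\<lambda>v. i y *\<^sub>v v) (carrier_vec (bundle_rank E' y)) \<and>
        (\<lambda>v. i y *\<^sub>v v) ` carrier_vec (bundle_rank E' y) =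
          {v \<in> carrier_vec (bundle_rank E y). p y *\<^sub>v v = 0\<^sub>v (bundle_rank E'' y)} \<and>
        (\<lambda>v. p y *\<^sub>v v) ` carrier_vec (bundle_rank E y) = carrier_vec (bundle_rank E'' y))"

definition kronecker_product ::
    "complex Matrix.mat \<Rightarrow> complex Matrix.mat \<Rightarrow> complex Matrix.mat" where
  "kronecker_product A B = Matrix.mat (dim_row A * dim_row B) (dim_col A * dim_col B)
     (\<lambda>(i, j). A $$ (i div dim_row B, j div dim_col B) * B $$ (i mod dim_row B, j mod dim_col B))"

definition tensor_bundle :: "('y, complex^'n^'n) rep_family \<Rightarrow> ('y, complex^'n^'n) rep_family \<Rightarrow> ('y, complex^'n^'n) rep_family" where
  "tensor_bundle E F = (\<lambda>y t. kronecker_product (E y t) (F y t))"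

text \<open>The free abelian group on all bundles, with the bilinear extension of the tensor product.\<close>

definition bundle_ring ::
    "(complex^'n^'n) set \<Rightarrow> 'y set \<Rightarrow> (('y, complex^'n^'n) rep_family \<Rightarrow>\<^sub>0 int) ring" where
  "bundle_ring T Y =
     \<lparr>carrier = {c. Poly_Mapping.keys c \<subseteq> vector_bundles T Y},
      monoid.mult = (\<lambda>c d. frag_extend (\<lambda>E. frag_extend (\<lambda>F. frag_of (tensor_bundle E F)) d) c),
      one = frag_of (\<lambda>y t. 1\<^sub>m 1),
      zero = 0,
      add = (+)\<rparr>"

definition exactness_relations ::
    "(complex^'n^'n) set \<Rightarrow> 'y set \<Rightarrow> (('y, complex^'n^'n) rep_family \<Rightarrow>\<^sub>0 int) set" where
  "exactness_relations T Y = generate (add_monoid (bundle_ring T Y))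
     {frag_of E - frag_of E' - frag_of E'' | E E' E''.
        E \<in> vector_bundles T Y \<and> E' \<in> vector_bundles T Y \<and> E'' \<in> vector_bundles T Y \<and>
        short_exact T Y E' E E''}"

text \<open>The Grothendieck ring of \<open>T\<close>-equivariant vector bundles on \<open>Y\<close>. The representation ring
  \<open>R(T)\<close> is the case where \<open>Y\<close> is a point.\<close>

definition K0 :: "(complex^'n^'n) set \<Rightarrow> 'y set \<Rightarrow> (('y, complex^'n^'n) rep_family \<Rightarrow>\<^sub>0 int) set ring" where
  "K0 T Y = bundle_ring T Y Quot exactness_relations T Y"

text \<open>Pullback of bundles along \<open>f : X \<rightarrow> Y\<close>, extended to K-classes. Each member of the class
  gives the same coset in the union.\<close>

definition K0_pullback ::
    "(complex^'n^'n) set \<Rightarrow> 'x set \<Rightarrow> ('x \<Rightarrow> 'y) \<Rightarrow>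
     (('y, complex^'n^'n) rep_family \<Rightarrow>\<^sub>0 int) set \<Rightarrow> (('x, complex^'n^'n) rep_family \<Rightarrow>\<^sub>0 int) set" where
  "K0_pullback T X f \<kappa> = (\<Union>c\<in>\<kappa>. exactness_relations T X +>\<^bsub>bundle_ring T X\<^esub>
     frag_extend (\<lambda>E. frag_of (\<lambda>x. E (f x))) c)"

text \<open>Restriction to a point \<open>y\<close>, with values in \<open>R(T)\<close>: this is the value at \<open>y\<close> of a class
  regarded as a map from points to \<open>R(T)\<close>.\<close>

definition K0_at ::
    "(complex^'n^'n) set \<Rightarrow> 'y \<Rightarrow> (('y, complex^'n^'n) rep_family \<Rightarrow>\<^sub>0 int) set \<Rightarrow>
     ((unit, complex^'n^'n) rep_family \<Rightarrow>\<^sub>0 int) set" where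
  "K0_at T y \<kappa> = K0_pullback T (UNIV :: unit set) (\<lambda>_. y) \<kappa>"

end

theory Submission
  imports Defs "HOL-Algebra.Zassenhaus"
begin

text \<open>
  Writing \<open>w = nT\<close> and \<open>\<sigma> = sT\<close>, the point \<open>w.B'\<close> is \<open>nB'n\<^sup>-\<^sup>1\<close>, so equivariance and the value of
  \<open>\<iota>\<close> at the base point give \<open>\<iota>(w.B') = n(sBs\<^sup>-\<^sup>1)n\<^sup>-\<^sup>1 = (w\<sigma>).B\<close>. The claim is then functoriality
  of pullback along \<open>pt \<rightarrow> (F')\<^sup>T \<rightarrow> F\<^sup>T\<close>, which holds at the level of cosets because exact
  sequences pull back to exact sequences.
\<close>

section \<open>Conjugation of flags\<close>

lemma group_GL: "group (GL :: (complex^'n^'n) monoid)"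
proof (rule groupI)
  show "x \<otimes>\<^bsub>GL\<^esub> y \<in> carrier GL" if "x \<in> carrier GL" "y \<in> carrier GL" for x y :: "complex^'n^'n"
    using that by (simp add: GL_def invertible_mult)
  show "\<one>\<^bsub>GL\<^esub> \<in> (carrier GL :: (complex^'n^'n) set)"
    unfolding GL_def by (simp add: invertible_def)
  show "\<exists>y\<in>carrier GL. y \<otimes>\<^bsub>GL\<^esub> x = \<one>\<^bsub>GL\<^esub>" if "x \<in> carrier GL" for x :: "complex^'n^'n"
    using that by (simp add: GL_def invertible_def) metis
qed (simp_all add: GL_def matrix_mul_assoc)

interpretation GL: group GL
  by (rule group_GL)

lemma conjugate_set_image: "conjugate_set g S = (\<lambda>x. g \<otimes>\<^bsub>GL\<^esub> x \<otimes>\<^bsub>GL\<^esub> inv\<^bsub>GL\<^esub> g) ` S"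
  by (auto simp: conjugate_set_def l_coset_def r_coset_def)

lemma conjugate_set_mult:
  assumes "g \<in> carrier GL" "h \<in> carrier GL" "S \<subseteq> carrier GL"
  shows "conjugate_set (g \<otimes>\<^bsub>GL\<^esub> h) S = conjugate_set g (conjugate_set h S)"
  unfolding conjugate_set_image image_image using assms
  by (intro image_cong refl) (auto simp: GL.m_assoc GL.inv_mult_group subset_iff)

lemma conjugate_set_self:
  assumes "subgroup B GL" "b \<in> B"
  shows "conjugate_set b B = B"
  using assms
  by (simp add: conjugate_set_def GL.coset_join3 GL.coset_join2 subgroup.mem_carrier
      subgroup.m_inv_closed)

text \<open>Right multiplication by an element of \<open>B\<close> does not change the conjugate of
  \<open>B\<close>, so the image under \<open>the_elem\<close> in \<open>flag_point\<close> is a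
  singleton. Allowing any nonempty subset of the coset \<open>aB\<close> covers cosets of
  \<open>T\<close>, products of two such cosets, and single elements at once.\<close>

lemma flag_point_eq:
  assumes B: "subgroup B GL" and a: "a \<in> carrier GL" and w: "w \<noteq> {}" "w \<subseteq> a <#\<^bsub>GL\<^esub> B"
  shows "flag_point B w = conjugate_set a B"
proof -
  have "conjugate_set g B = conjugate_set a B" if g: "g \<in> w" for g
  proof -
    obtain b where b: "b \<in> B" "g = a \<otimes>\<^bsub>GL\<^esub> b"
      using g w(2) by (auto simp: l_coset_def)
    show ?thesis
      using conjugate_set_mult[OF a subgroup.mem_carrier[OF B b(1)] subgroup.subset[OF B]]
        conjugate_set_self[OF B b(1)]
      by (simp add: b(2))
  qed
  then have "(\<lambda>g. conjugate_set g B) ` w = {conjugate_set a B}"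
    using w(1) by auto
  then show ?thesis
    by (simp add: flag_point_def)
qed

text \<open>\<open>T\<close> is normal in its normalizer, so a single representative serves both
  coset forms. The left form gives the flag point; the right form lets \<open>T\<close> act from the
  left. Both are stated in \<open>GL\<close>, so that elements of different Weyl groups can be
  compared.\<close>

lemma weyl_group_carrierE:
  assumes G: "subgroup G GL" and T: "subgroup T GL" "T \<subseteq> G"
    and w: "w \<in> carrier (weyl_group G T)"
  obtains n where "n \<in> G" "w = T #>\<^bsub>GL\<^esub> n" "w = n <#\<^bsub>GL\<^esub> T"
proof -
  let ?N = "normalizer (lin G) T"
  have "group (lin G)"
    using G by (rule subgroup.subgroup_is_group) (rule group_GL)
  moreover have "subgroup T (lin G)"
    using T G GL.subgroup_incl by blast
  ultimately have "T \<lhd> lin ?N"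
    using group.subgroup_in_normalizer[of "lin G" T] by simp
  then have eq: "T #>\<^bsub>lin ?N\<^esub> n = n <#\<^bsub>lin ?N\<^esub> T" if "n \<in> ?N" for n
    using that normal.coset_eq[of T "lin ?N"] by simp
  obtain n where n: "n \<in> ?N" "w = T #>\<^bsub>lin ?N\<^esub> n"
    using w by (auto simp: weyl_group_def carrier_FactGroup)
  have "n \<in> G"
    using n(1) by (simp add: normalizer_def stabilizer_def)
  moreover have "w = T #>\<^bsub>GL\<^esub> n"
    using n(2) by (simp add: r_coset_def)
  moreover have "w = n <#\<^bsub>GL\<^esub> T"
    using n(2) eq[OF n(1)] by (simp add: l_coset_def)
  ultimately show thesis ..
qed

text \<open>Commutativity is transported along the isomorphism from a power of \<open>Gm\<close>,
  where multiplication is componentwise.\<close>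

lemma torus_commute:
  assumes "torus T" "s \<in> T" "t \<in> T"
  shows "s \<otimes>\<^bsub>GL\<^esub> t = t \<otimes>\<^bsub>GL\<^esub> s"
proof -
  obtain r f where f: "f \<in> iso (Gm_power r) (lin T)"
    using assms(1) unfolding torus_def by blast
  obtain x y where xy: "x \<in> carrier (Gm_power r)" "y \<in> carrier (Gm_power r)" "s = f x" "t = f y"
    using f assms(2,3) unfolding iso_def bij_betw_def by auto
  have "f (x \<otimes>\<^bsub>Gm_power r\<^esub> y) = f x \<otimes>\<^bsub>GL\<^esub> f y" "f (y \<otimes>\<^bsub>Gm_power r\<^esub> x) = f y \<otimes>\<^bsub>GL\<^esub> f x"
    using f xy(1,2) by (auto simp: iso_def hom_def)
  moreover have "x \<otimes>\<^bsub>Gm_power r\<^esub> y = y \<otimes>\<^bsub>Gm_power r\<^esub> x"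
    by (simp add: Gm_def mult.commute)
  ultimately show ?thesis
    using xy by simp
qed

lemma subgroup_centralizer:
  assumes "subgroup G GL" "S \<subseteq> carrier GL"
  shows "subgroup (centralizer G S) GL"
proof (rule GL.subgroupI)
  show "centralizer G S \<subseteq> carrier GL"
    using subgroup.subset[OF assms(1)] by (auto simp: centralizer_def)
  have "\<one>\<^bsub>GL\<^esub> \<in> centralizer G S"
    using assms by (auto simp: centralizer_def subgroup.one_closed subset_iff)
  then show "centralizer G S \<noteq> {}"
    by blast
next
  fix a assume "a \<in> centralizer G S"
  then have a: "a \<in> G" "a \<in> carrier GL" and c: "\<And>s. s \<in> S \<Longrightarrow> a \<otimes>\<^bsub>GL\<^esub> s = s \<otimes>\<^bsub>GL\<^esub> a"
    using subgroup.subset[OF assms(1)] by (auto simp: centralizer_def)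
  have "inv\<^bsub>GL\<^esub> a \<otimes>\<^bsub>GL\<^esub> s = s \<otimes>\<^bsub>GL\<^esub> inv\<^bsub>GL\<^esub> a" if "s \<in> S" for s
  proof -
    have s: "s \<in> carrier GL"
      using that assms(2) by auto
    \<comment> \<open>Insert \<open>a\<close> times its inverse after \<open>s\<close>; then
      \<open>s\<close> and \<open>a\<close> can be swapped and the left factor cancels.\<close>
    have "inv\<^bsub>GL\<^esub> a \<otimes>\<^bsub>GL\<^esub> s = inv\<^bsub>GL\<^esub> a \<otimes>\<^bsub>GL\<^esub> (s \<otimes>\<^bsub>GL\<^esub> a) \<otimes>\<^bsub>GL\<^esub> inv\<^bsub>GL\<^esub> a"
      using a(2) s by (simp add: GL.m_assoc)
    also have "\<dots> = s \<otimes>\<^bsub>GL\<^esub> inv\<^bsub>GL\<^esub> a"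
      using a(2) s by (simp add: c[OF that, symmetric] GL.m_assoc[symmetric])
    finally show ?thesis .
  qed
  then show "inv\<^bsub>GL\<^esub> a \<in> centralizer G S"
    using a(1) assms(1) by (simp add: centralizer_def subgroup.m_inv_closed)
next
  fix a b assume "a \<in> centralizer G S" "b \<in> centralizer G S"
  then have ab: "a \<in> G" "b \<in> G" "a \<in> carrier GL" "b \<in> carrier GL"
    and c: "\<And>s. s \<in> S \<Longrightarrow> a \<otimes>\<^bsub>GL\<^esub> s = s \<otimes>\<^bsub>GL\<^esub> a" "\<And>s. s \<in> S \<Longrightarrow> b \<otimes>\<^bsub>GL\<^esub> s = s \<otimes>\<^bsub>GL\<^esub> b"
    using subgroup.subset[OF assms(1)] by (auto simp: centralizer_def)
  have "a \<otimes>\<^bsub>GL\<^esub> b \<otimes>\<^bsub>GL\<^esub> s = s \<otimes>\<^bsub>GL\<^esub> (a \<otimes>\<^bsub>GL\<^esub> b)" if "s \<in> S" for s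
  proof -
    have s: "s \<in> carrier GL"
      using that assms(2) by auto
    have "a \<otimes>\<^bsub>GL\<^esub> b \<otimes>\<^bsub>GL\<^esub> s = (a \<otimes>\<^bsub>GL\<^esub> s) \<otimes>\<^bsub>GL\<^esub> b"
      using ab(3,4) s by (simp add: GL.m_assoc c(2)[OF that])
    then show ?thesis
      using ab(3,4) s by (simp add: GL.m_assoc c(1)[OF that])
  qed
  then show "a \<otimes>\<^bsub>GL\<^esub> b \<in> centralizer G S"
    using ab(1,2) assms(1) by (simp add: centralizer_def subgroup.m_closed)
qed

text \<open>For \<open>w = nT = Tn\<close> and \<open>t\<close> in \<open>T\<close>, the element
  \<open>tn\<close> lies in \<open>nT\<close> and hence in \<open>nB\<close>, so \<open>t\<close>
  fixes the flag of \<open>n\<close>.\<close>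

lemma flag_point_fixed:
  assumes G: "subgroup G GL" and B: "subgroup B GL" and T: "subgroup T GL" "T \<subseteq> G" "T \<subseteq> B"
    and w: "w \<in> carrier (weyl_group G T)"
  shows "flag_point B w \<in> fixed_points T (flag_variety G B)"
proof -
  obtain n where n: "n \<in> G" "w = T #>\<^bsub>GL\<^esub> n" "w = n <#\<^bsub>GL\<^esub> T"
    using weyl_group_carrierE[OF G T(1,2) w] .
  have nGL: "n \<in> carrier GL"
    using n(1) G by (rule subgroup.mem_carrier[rotated])
  have ne: "T \<noteq> {}"
    using subgroup.one_closed[OF T(1)] by blast
  have pt: "flag_point B w = conjugate_set n B"
    using ne T(3) by (intro flag_point_eq[OF B nGL]) (auto simp: n(3) l_coset_def)
  have "conjugate_set t (conjugate_set n B) = conjugate_set n B" if t: "t \<in> T" for t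
  proof -
    have tGL: "t \<in> carrier GL"
      using T(1) t by (rule subgroup.mem_carrier)
    have "t \<otimes>\<^bsub>GL\<^esub> n \<in> w"
      using t by (auto simp: n(2) r_coset_def)
    then have "{t \<otimes>\<^bsub>GL\<^esub> n} \<subseteq> n <#\<^bsub>GL\<^esub> B"
      using T(3) by (auto simp: n(3) l_coset_def)
    \<comment> \<open>The singleton is a legitimate nonempty subset of \<open>nB\<close>, so its
      flag point is at the same time the conjugate of \<open>B\<close> by \<open>tn\<close>.\<close>
    then have "flag_point B {t \<otimes>\<^bsub>GL\<^esub> n} = conjugate_set n B"
      by (intro flag_point_eq[OF B nGL]) auto
    then show ?thesis
      using conjugate_set_mult[OF tGL nGL subgroup.subset[OF B]] by (simp add: flag_point_def)
  qed
  then show ?thesis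
    using n(1) by (auto simp: pt fixed_points_def flag_variety_def)
qed

section \<open>Pullback of K-classes\<close>

text \<open>The homomorphism of free abelian groups that induces \<open>K0_pullback\<close> on
  cosets.\<close>

abbreviation pullback_chain ::
    "('x \<Rightarrow> 'y) \<Rightarrow> (('y, complex^'n^'n) rep_family \<Rightarrow>\<^sub>0 int) \<Rightarrow> (('x, complex^'n^'n) rep_family \<Rightarrow>\<^sub>0 int)"
  where "pullback_chain f \<equiv> frag_extend (\<lambda>E. frag_of (\<lambda>x. E (f x)))"

lemma pullback_chain_comp:
  "pullback_chain g (pullback_chain f c) = pullback_chain (\<lambda>x. f (g x)) c"
  using frag_extend_compose[of "\<lambda>E. frag_of (\<lambda>x. E (g x))" "\<lambda>E x. E (f x)" c]
  by (simp add: o_def)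

section \<open>The additive group of bundles and its subgroup of exactness relations\<close>

lemma group_add_bundle_ring: "group (add_monoid (bundle_ring T Y))"
proof (rule groupI)
  fix x assume x: "x \<in> carrier (add_monoid (bundle_ring T Y))"
  show "\<exists>y\<in>carrier (add_monoid (bundle_ring T Y)).
      y \<otimes>\<^bsub>add_monoid (bundle_ring T Y)\<^esub> x = \<one>\<^bsub>add_monoid (bundle_ring T Y)\<^esub>"
    using x by (intro bexI[of _ "- x"]) (auto simp: bundle_ring_def keys_minus)
qed (auto simp: bundle_ring_def add.assoc dest!: subsetD[OF keys_add])

text \<open>Identifies the abstract inverse with pointwise negation, so that closure of the
  relations under inverses can be used in ordinary arithmetic.\<close>

lemma inv_add_bundle_ring:
  assumes "x \<in> carrier (bundle_ring T Y)"
  shows "inv\<^bsub>add_monoid (bundle_ring T Y)\<^esub> x = - x"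
  using assms
  by (intro group.inv_equality[OF group_add_bundle_ring]) (auto simp: bundle_ring_def keys_minus)

lemma exactness_generators:
  assumes "E \<in> vector_bundles T Y" "E' \<in> vector_bundles T Y" "E'' \<in> vector_bundles T Y"
  shows "frag_of E - frag_of E' - frag_of E'' \<in> carrier (bundle_ring T Y)"
  using assms keys_diff[of "frag_of E - frag_of E'" "frag_of E''"] keys_diff[of "frag_of E" "frag_of E'"]
  by (auto simp: bundle_ring_def)

lemma subgroup_exactness_relations:
  "subgroup (exactness_relations T Y) (add_monoid (bundle_ring T Y))"
  unfolding exactness_relations_def
  using exactness_generators
  by (intro group.generate_is_subgroup[OF group_add_bundle_ring]) auto

lemma exactness_relations_zero: "0 \<in> exactness_relations T Y"
  using subgroup.one_closed[OF subgroup_exactness_relations[of T Y]] by (simp add: bundle_ring_def)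

lemma exactness_relations_add:
  "x \<in> exactness_relations T Y \<Longrightarrow> y \<in> exactness_relations T Y \<Longrightarrow> x + y \<in> exactness_relations T Y"
  using subgroup.m_closed[OF subgroup_exactness_relations[of T Y], of x y]
  by (simp add: bundle_ring_def)

lemma exactness_relations_uminus:
  assumes "x \<in> exactness_relations T Y"
  shows "- x \<in> exactness_relations T Y"
  using subgroup.m_inv_closed[OF subgroup_exactness_relations assms] inv_add_bundle_ring[of x T Y]
    subgroup.mem_carrier[OF subgroup_exactness_relations assms]
  by simp

text \<open>Equivariance and exactness are conditions at each point separately, and the fibre over
  \<open>x\<close> of a pulled-back bundle is the fibre over \<open>f x\<close>; the maps of the
  sequence are therefore reindexed by \<open>f\<close>.\<close>

lemma short_exact_pullback:
  assumes "f ` X \<subseteq> Y" "short_exact T Y E' E E''"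
  shows "short_exact T X (\<lambda>x. E' (f x)) (\<lambda>x. E (f x)) (\<lambda>x. E'' (f x))"
proof -
  obtain i p where "i \<in> bundle_hom T Y E' E" "p \<in> bundle_hom T Y E E''"
    and *: "\<forall>y\<in>Y. inj_on (\<lambda>v. i y *\<^sub>v v) (carrier_vec (bundle_rank E' y)) \<and>
        (\<lambda>v. i y *\<^sub>v v) ` carrier_vec (bundle_rank E' y) =
          {v \<in> carrier_vec (bundle_rank E y). p y *\<^sub>v v = 0\<^sub>v (bundle_rank E'' y)} \<and>
        (\<lambda>v. p y *\<^sub>v v) ` carrier_vec (bundle_rank E y) = carrier_vec (bundle_rank E'' y)"
    using assms(2) unfolding short_exact_def by blast
  then have "(\<lambda>x. i (f x)) \<in> bundle_hom T X (\<lambda>x. E' (f x)) (\<lambda>x. E (f x))"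
    "(\<lambda>x. p (f x)) \<in> bundle_hom T X (\<lambda>x. E (f x)) (\<lambda>x. E'' (f x))"
    using assms(1) by (auto simp: bundle_hom_def bundle_rank_def)
  moreover have "\<forall>x\<in>X. f x \<in> Y"
    using assms(1) by blast
  ultimately show ?thesis
    unfolding short_exact_def using *
    by (intro bexI[of _ "\<lambda>x. i (f x)"] bexI[of _ "\<lambda>x. p (f x)"]) (simp_all add: bundle_rank_def)
qed

text \<open>Chain pullback is additive and sends each generator to the generator of the pulled-back
  sequence; induction on generation extends this to the whole subgroup. This is what makes pullback
  well defined on cosets.\<close>

lemma pullback_exactness_relations:
  assumes f: "f ` X \<subseteq> Y" and c: "c \<in> exactness_relations T Y"
  shows "pullback_chain f c \<in> exactness_relations T X"
proof -
  have gen: "pullback_chain f (frag_of E - frag_of E' - frag_of E'') \<in> exactness_relations T X"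
    if "E \<in> vector_bundles T Y" "E' \<in> vector_bundles T Y" "E'' \<in> vector_bundles T Y"
      "short_exact T Y E' E E''" for E E' E''
  proof -
    have "(\<lambda>x. E (f x)) \<in> vector_bundles T X" "(\<lambda>x. E' (f x)) \<in> vector_bundles T X"
      "(\<lambda>x. E'' (f x)) \<in> vector_bundles T X"
      using that f by (auto simp: vector_bundles_def)
    then show ?thesis
      unfolding exactness_relations_def using short_exact_pullback[OF f that(4)]
      by (intro generate.incl) (auto simp: frag_extend_diff)
  qed
  show ?thesis
    using c unfolding exactness_relations_def[of T Y]
  proof (induction rule: generate.induct)
    case one
    then show ?case
      by (simp add: bundle_ring_def exactness_relations_zero)
  next
    case (incl h)
    then show ?case
      using gen by blast
  next
    case (inv h)
    then obtain E E' E'' where h: "h = frag_of E - frag_of E' - frag_of E''"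
      "E \<in> vector_bundles T Y" "E' \<in> vector_bundles T Y" "E'' \<in> vector_bundles T Y"
      "short_exact T Y E' E E''"
      by blast
    have "inv\<^bsub>add_monoid (bundle_ring T Y)\<^esub> h = - h"
      using exactness_generators[OF h(2-4)] by (intro inv_add_bundle_ring) (simp add: h(1))
    then show ?case
      using exactness_relations_uminus[OF gen[OF h(2-5)]] frag_extend_minus[of _ h] h(1)
      by metis
  next
    case (eng a b)
    then show ?case
      using exactness_relations_add by (simp add: bundle_ring_def frag_extend_add)
  qed
qed

section \<open>Cosets of relations and functoriality of pullback\<close>

lemma exactness_coset:
  "exactness_relations T Y +>\<^bsub>bundle_ring T Y\<^esub> a = {r + a | r. r \<in> exactness_relations T Y}"
  by (auto simp: a_r_coset_def r_coset_def bundle_ring_def)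

lemma exactness_coset_absorb:
  assumes "i \<in> exactness_relations T Y"
  shows "exactness_relations T Y +>\<^bsub>bundle_ring T Y\<^esub> (i + a) =
    exactness_relations T Y +>\<^bsub>bundle_ring T Y\<^esub> a"
  unfolding exactness_coset
proof (intro Collect_cong iffI; elim exE conjE)
  fix x r assume "x = r + (i + a)" "r \<in> exactness_relations T Y"
  then show "\<exists>r. x = r + a \<and> r \<in> exactness_relations T Y"
    using assms exactness_relations_add by (intro exI[of _ "r + i"]) (auto simp: algebra_simps)
next
  fix x r assume "x = r + a" "r \<in> exactness_relations T Y"
  then show "\<exists>r. x = r + (i + a) \<and> r \<in> exactness_relations T Y"
    using exactness_relations_add[OF _ exactness_relations_uminus[OF assms], of r]
    by (intro exI[of _ "r + - i"] conjI) (simp_all add: algebra_simps)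
qed

lemma K0_pullback_comp:
  assumes "g ` X \<subseteq> Y"
  shows "K0_pullback T X g (K0_pullback T Y f \<kappa>) = K0_pullback T X (\<lambda>x. f (g x)) \<kappa>"
proof -
  let ?R = "\<lambda>c. exactness_relations T X +>\<^bsub>bundle_ring T X\<^esub> c"
  have "(\<Union>d \<in> exactness_relations T Y +>\<^bsub>bundle_ring T Y\<^esub> pullback_chain f c.
      ?R (pullback_chain g d)) = ?R (pullback_chain (\<lambda>x. f (g x)) c)" for c
  proof -
    have "?R (pullback_chain g (r + pullback_chain f c)) = ?R (pullback_chain (\<lambda>x. f (g x)) c)"
      if "r \<in> exactness_relations T Y" for r
      using exactness_coset_absorb[OF pullback_exactness_relations[OF assms that]]
      by (simp add: frag_extend_add pullback_chain_comp)
    then show ?thesis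
      \<comment> \<open>All terms of the union are equal; the zero relation shows that the index set
        is nonempty, so the union is that common coset.\<close>
      using exactness_relations_zero[of T Y] unfolding exactness_coset[of T Y] by blast
  qed
  then show ?thesis
    by (simp add: K0_pullback_def)
qed

section \<open>The section at \<open>T\<close>-fixed points and the restriction formula\<close>

theorem proposition4p2:
  fixes G B T :: "(complex^'n^'n) set"
    and \<eta> :: "complex \<Rightarrow> complex^'n^'n"
    and \<sigma> w :: "(complex^'n^'n) set"
    and \<iota> :: "(complex^'n^'n) set \<Rightarrow> (complex^'n^'n) set"
    and \<phi> :: "(((complex^'n^'n) set, complex^'n^'n) rep_family \<Rightarrow>\<^sub>0 int) set"
  assumes "semisimple_group G" and "simply_connected G"
    and "borel_subgroup G B" and "maximal_torus G T" and "T \<subseteq> B"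
    and "cocharacter T \<eta>"
    and "\<sigma> \<in> carrier (weyl_group G T)"
    and "\<forall>v \<in> carrier (weyl_group (pattern_group G \<eta>) T) #>\<^bsub>weyl_group G T\<^esub> \<sigma>.
           weyl_length G B T \<sigma> \<le> weyl_length G B T v"
    and "pattern_section G B T \<eta> \<sigma> \<iota>"
    and "\<phi> \<in> carrier (K0 T (fixed_points T (flag_variety G B)))"
    and "w \<in> carrier (weyl_group (pattern_group G \<eta>) T)"
  shows "K0_at T (flag_point (pattern_borel G B \<eta>) w)
           (K0_pullback T (fixed_points T (pattern_flag_variety G B \<eta>)) \<iota> \<phi>) =
         K0_at T (flag_point B (w \<otimes>\<^bsub>weyl_group G T\<^esub> \<sigma>)) \<phi>"
proof -
  let ?G' = "pattern_group G \<eta>" and ?B' = "pattern_borel G B \<eta>"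
  have G: "subgroup G GL" and B: "subgroup B GL" "B \<subseteq> G"
    and torus: "torus T" and T: "subgroup T GL" "T \<subseteq> G"
    using assms(1,3,4) by (auto simp: semisimple_group_def borel_subgroup_def maximal_torus_def
        connected_algebraic_group_def linear_algebraic_group_def torus_def)
  have im: "cocharacter_image \<eta> \<subseteq> T"
    using assms(6) by (auto simp: cocharacter_def cocharacter_image_def hom_def)
  \<comment> \<open>The image of \<open>\<eta>\<close> lies in the commutative group
    \<open>T\<close>, so \<open>T\<close> centralizes it.\<close>
  have TG': "T \<subseteq> ?G'"
    using T(2) im torus_commute[OF torus] by (auto simp: centralizer_def)
  have G': "subgroup ?G' GL"
    using G im subgroup.subset[OF T(1)] by (intro subgroup_centralizer) auto
  have B': "subgroup ?B' GL"
    using GL.subgroups_Inter_pair[OF G' B(1)] .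
  have TB': "T \<subseteq> ?B'"
    using TG' assms(5) by simp
  obtain n where n: "n \<in> ?G'" "w = T #>\<^bsub>GL\<^esub> n" "w = n <#\<^bsub>GL\<^esub> T"
    using weyl_group_carrierE[OF G' T(1) TG' assms(11)] .
  obtain s where s: "s \<in> G" "\<sigma> = T #>\<^bsub>GL\<^esub> s" "\<sigma> = s <#\<^bsub>GL\<^esub> T"
    using weyl_group_carrierE[OF G T assms(7)] .
  have nGL: "n \<in> carrier GL" and sGL: "s \<in> carrier GL"
    using n(1) s(1) G G' by (auto dest: subgroup.mem_carrier)
  have ne: "T \<noteq> {}"
    using subgroup.one_closed[OF T(1)] by blast
  have ptw: "flag_point ?B' w = conjugate_set n ?B'"
    using ne TB' by (intro flag_point_eq[OF B' nGL]) (auto simp: n(3) l_coset_def)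
  have pts: "flag_point B \<sigma> = conjugate_set s B"
    using ne assms(5) by (intro flag_point_eq[OF B(1) sGL]) (auto simp: s(3) l_coset_def)
  \<comment> \<open>The identity of the Weyl group is the coset \<open>T\<close>, contained in
    \<open>B'\<close>; the base point is thus \<open>B'\<close> itself.\<close>
  have one: "flag_point ?B' \<one>\<^bsub>weyl_group ?G' T\<^esub> = ?B'"
  proof -
    have "flag_point ?B' T = conjugate_set \<one>\<^bsub>GL\<^esub> ?B'"
      using ne TB' subgroup.subset[OF B']
      by (intro flag_point_eq[OF B']) (simp_all add: GL.lcos_mult_one)
    then show ?thesis
      using conjugate_set_self[OF B' subgroup.one_closed[OF B']]
      by (simp add: weyl_group_def FactGroup_def)
  qed
  have ptws: "flag_point B (w \<otimes>\<^bsub>weyl_group G T\<^esub> \<sigma>) = conjugate_set (n \<otimes>\<^bsub>GL\<^esub> s) B"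
  proof (rule flag_point_eq[OF B(1)])
    \<comment> \<open>Multiplication in the quotient is the product of subsets of \<open>GL\<close>,
      so \<open>w\<close>, a coset from the smaller Weyl group, multiplies \<open>\<sigma>\<close>
      directly.\<close>
    have prod: "w \<otimes>\<^bsub>weyl_group G T\<^esub> \<sigma> = w <#>\<^bsub>GL\<^esub> \<sigma>"
      by (simp add: weyl_group_def FactGroup_def set_mult_def)
    show "w \<otimes>\<^bsub>weyl_group G T\<^esub> \<sigma> \<noteq> {}"
      unfolding prod using ne by (auto simp: n(2) s(2) set_mult_def r_coset_def)
    show "w \<otimes>\<^bsub>weyl_group G T\<^esub> \<sigma> \<subseteq> (n \<otimes>\<^bsub>GL\<^esub> s) <#\<^bsub>GL\<^esub> B"
    proof
      fix x assume "x \<in> w \<otimes>\<^bsub>weyl_group G T\<^esub> \<sigma>"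
      then have "x \<in> w <#>\<^bsub>GL\<^esub> \<sigma>"
        by (simp only: prod)
      then obtain t u where tu: "t \<in> T" "u \<in> T" "x = (n \<otimes>\<^bsub>GL\<^esub> t) \<otimes>\<^bsub>GL\<^esub> (u \<otimes>\<^bsub>GL\<^esub> s)"
        by (auto simp: n(3) s(2) set_mult_def l_coset_def r_coset_def)
      \<comment> \<open>Since \<open>Ts = sT\<close>, the torus factor between \<open>n\<close> and
        \<open>s\<close> moves to the right of \<open>s\<close>, where it is absorbed by
        \<open>B\<close>.\<close>
      have "(t \<otimes>\<^bsub>GL\<^esub> u) \<otimes>\<^bsub>GL\<^esub> s \<in> \<sigma>"
        using tu(1,2) subgroup.m_closed[OF T(1)] by (auto simp: s(2) r_coset_def)
      then obtain v where v: "v \<in> T" "(t \<otimes>\<^bsub>GL\<^esub> u) \<otimes>\<^bsub>GL\<^esub> s = s \<otimes>\<^bsub>GL\<^esub> v"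
        by (auto simp: s(3) l_coset_def)
      have c: "t \<in> carrier GL" "u \<in> carrier GL" "v \<in> carrier GL"
        using tu v(1) subgroup.subset[OF T(1)] by auto
      have "x = n \<otimes>\<^bsub>GL\<^esub> ((t \<otimes>\<^bsub>GL\<^esub> u) \<otimes>\<^bsub>GL\<^esub> s)"
        using c nGL sGL by (simp add: tu(3) GL.m_assoc)
      then have "x = (n \<otimes>\<^bsub>GL\<^esub> s) \<otimes>\<^bsub>GL\<^esub> v"
        using c nGL sGL by (simp add: v(2) GL.m_assoc)
      then show "x \<in> (n \<otimes>\<^bsub>GL\<^esub> s) <#\<^bsub>GL\<^esub> B"
        using v(1) assms(5) by (auto simp: l_coset_def)
    qed
  qed (use nGL sGL in simp)
  have equivariant: "\<iota> (conjugate_set g b) = conjugate_set g (\<iota> b)"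
    if "g \<in> ?G'" "b \<in> pattern_flag_variety G B \<eta>" for g b
    using assms(9) that unfolding pattern_section_def Let_def by blast
  have base: "\<iota> ?B' = flag_point B \<sigma>"
    using assms(9) one unfolding pattern_section_def Let_def by simp
  \<comment> \<open>Equivariance is available only at points of the flag variety; \<open>B'\<close>
    is one, as its own conjugate by the identity.\<close>
  have "?B' \<in> pattern_flag_variety G B \<eta>"
    using subgroup.one_closed[OF G'] conjugate_set_self[OF B' subgroup.one_closed[OF B']]
    by (force simp: flag_variety_def)
  then have "\<iota> (flag_point ?B' w) = flag_point B (w \<otimes>\<^bsub>weyl_group G T\<^esub> \<sigma>)"
    using equivariant[OF n(1)] conjugate_set_mult[OF nGL sGL subgroup.subset[OF B(1)]]
    by (simp add: ptw ptws pts base)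
  \<comment> \<open>This puts the image of the constant map from a point inside the fixed locus, as
    \<open>K0_pullback_comp\<close> requires.\<close>
  moreover have "flag_point ?B' w \<in> fixed_points T (pattern_flag_variety G B \<eta>)"
    using flag_point_fixed[OF G' B' T(1) TG' TB' assms(11)] .
  ultimately show ?thesis
    unfolding K0_at_def
    using K0_pullback_comp[of "\<lambda>_. flag_point ?B' w" UNIV
        "fixed_points T (pattern_flag_variety G B \<eta>)" T \<iota> \<phi>]
    by simp
qed

end
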